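(* Let $n\ge 1$ and let $K$ be the complete graph on $n$ vertices. Then every orbit of toric promotion $\mathrm{TPro}:\Omega_K\to\Omega_K$ has length $n$.
   Context: Toric promotion. Let $G=(V,E)$ be a finite simple graph (undirected, no loops, no multiple edges) on $N$ vertices. A labeling of $G$ is a bijection $\sigma:V\to\mathbb{Z}/N\mathbb{Z}=\{1,\dots,N\}$ (addition modulo $N$). A state is a pair $(\sigma,i)$ with $\sigma$ a labeling of $G$ and $i\in\mathbb{Z}/N\mathbb{Z}$; $\Omega_G$ is the set of all states. Toric promotion is the map $\mathrm{TPro}:\Omega_G\to\Omega_G$ given by $\mathrm{TPro}(\sigma,i)=(\sigma,i+1)$ if $\{\sigma^{-1}(i),\sigma^{-1}(i+1)\}\in E$, and $\mathrm{TPro}(\sigma,i)=((i,i+1)\circ\sigma,\,i+1)$ otherwise, where $(i,i+1)$ is the permutation of $\mathbb{Z}/N\mathbb{Z}$ swapping $i$ and $i+1$. It is a bijection of $\Omega_G$. The length of the orbit containing $(\sigma,i)$ is the least $L\ge 1$ with $\mathrm{TPro}^L(\sigma,i)=(\sigma,i)$. *)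

theory Defs
  imports "Graph_Theory.Graph_Theory" "HOL-Library.FuncSet" "HOL-Combinatorics.Transposition"
begin

text \<open>
  A finite simple graph is a \<^locale>\<open>graph\<close>, that is, a finite symmetric digraph without loops or
  multiple arcs; an undirected edge between u and v is a pair of opposite arcs.
  The integers modulo N are represented by the residues 1, ..., N.
\<close>

definition next_label :: "nat \<Rightarrow> nat \<Rightarrow> nat" where
  "next_label N i = i mod N + 1"  \<comment> \<open>on 1, ..., N: addition of 1 modulo N, with N followed by 1\<close>

definition labelings :: "('a, 'b) pre_digraph \<Rightarrow> ('a \<Rightarrow> nat) set" where
  "labelings G = {\<sigma> \<in> extensional (verts G). bij_betw \<sigma> (verts G) {1..card (verts G)}}"

definition states :: "('a, 'b) pre_digraph \<Rightarrow> (('a \<Rightarrow> nat) \<times> nat) set" where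
  "states G = labelings G \<times> {1..card (verts G)}"

text \<open>
  \<^const>\<open>compose\<close> is composition restricted to the vertex set, so labelings stay extensional and
  equality of states means equality on the vertices.
\<close>

fun TPro :: "('a, 'b) pre_digraph \<Rightarrow> ('a \<Rightarrow> nat) \<times> nat \<Rightarrow> ('a \<Rightarrow> nat) \<times> nat" where
  "TPro G (\<sigma>, i) =
    (let V = verts G; j = next_label (card V) i in
     if inv_into V \<sigma> i \<rightarrow>\<^bsub>G\<^esub> inv_into V \<sigma> j then (\<sigma>, j)
     else (compose V (transpose i j) \<sigma>, j))"

definition orbit_length :: "('s \<Rightarrow> 's) \<Rightarrow> 's \<Rightarrow> nat" where
  "orbit_length f s = (LEAST L. 1 \<le> L \<and> (f ^^ L) s = s)"

end

theory Submission
  imports Defs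
begin

text \<open>
  Any two distinct labels sit on adjacent vertices of a complete graph, so no swap ever happens:
  the labeling is constant and the second component cycles through all \<open>n\<close> residues.
\<close>

lemma TPro_complete:
  assumes "complete_digraph n K" and "\<sigma> \<in> labelings K" and "i \<in> {1..n}"
  shows "TPro K (\<sigma>, i) = (\<sigma>, next_label n i)"
proof -
  define j where "j = next_label n i"
  have n: "card (verts K) = n"
    and ends: "arcs_ends K = {(u, v). u \<in> verts K \<and> v \<in> verts K \<and> u \<noteq> v}"
    using assms(1) by (auto simp: complete_digraph_def)
  have ext: "\<sigma> \<in> extensional (verts K)" and bij: "bij_betw \<sigma> (verts K) {1..n}"
    using assms(2) n by (auto simp: labelings_def)
  have j: "j \<in> {1..n}"
    using assms(3) by (simp add: j_def next_label_def Suc_le_eq)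
  have img: "\<sigma> ` verts K = {1..n}"
    using bij by (rule bij_betw_imp_surj_on)
  show ?thesis
  proof (cases "i = j")
    case True  \<comment> \<open>only for \<open>n = 1\<close>, where the swap is trivial\<close>
    \<comment> \<open>Extensionality matters here: off the vertices, \<open>compose\<close> and
      \<open>\<sigma>\<close> are both \<open>undefined\<close>.\<close>
    have "compose (verts K) (transpose i j) \<sigma> = \<sigma>"
      using ext True by (auto simp: compose_def extensional_def)
    then show ?thesis
      using n by (simp add: Let_def j_def)
  next
    case False
    have "inv_into (verts K) \<sigma> i \<noteq> inv_into (verts K) \<sigma> j"
      using False assms(3) j img by (metis f_inv_into_f)
    moreover have "inv_into (verts K) \<sigma> i \<in> verts K" "inv_into (verts K) \<sigma> j \<in> verts K"
      using assms(3) j img by (metis inv_into_into)+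
    ultimately have "inv_into (verts K) \<sigma> i \<rightarrow>\<^bsub>K\<^esub> inv_into (verts K) \<sigma> j"
      using ends by auto
    then show ?thesis
      using n by (simp add: Let_def j_def)
  qed
qed

text \<open>In the zero-based residue \<open>i - 1\<close>, where \<open>i\<close> is at least 1,
  \<open>next_label\<close> is addition of 1 modulo \<open>n\<close>, so iterating it adds
  \<open>k\<close>.\<close>

lemma TPro_complete_funpow:
  assumes "complete_digraph n K" and "\<sigma> \<in> labelings K" and "i \<in> {1..n}"
  shows "(TPro K ^^ k) (\<sigma>, i) = (\<sigma>, (i - 1 + k) mod n + 1)"
proof (induction k)
  case 0
  then show ?case
    using assms(3) by auto
next
  case (Suc k)
  have "(i - 1 + k) mod n + 1 \<in> {1..n}"
    using assms(3) by (simp add: Suc_le_eq)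
  then have "TPro K (\<sigma>, (i - 1 + k) mod n + 1) = (\<sigma>, next_label n ((i - 1 + k) mod n + 1))"
    by (rule TPro_complete[OF assms(1,2)])
  with Suc show ?case
    by (simp add: next_label_def mod_Suc_eq)
qed

theorem proposition3:
  fixes K :: "('a, 'b) pre_digraph" and n :: nat
  assumes "n \<ge> 1" and "complete_digraph n K"
  shows "\<forall>s \<in> states K. orbit_length (TPro K) s = n"
proof
  fix s assume s: "s \<in> states K"
  have "card (verts K) = n"
    using assms(2) by (simp add: complete_digraph_def)
  with s obtain \<sigma> i where s_eq: "s = (\<sigma>, i)" and \<sigma>: "\<sigma> \<in> labelings K" and i: "i \<in> {1..n}"
    by (auto simp: states_def)
  \<comment> \<open>Finding all return times settles both that \<open>n\<close> is one and that no
    smaller positive one exists.\<close>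
  have period: "(TPro K ^^ k) s = s \<longleftrightarrow> n dvd k" for k
  proof -
    \<comment> \<open>The labeling never changes, so only second components are compared;
      \<open>i - 1 < n\<close> gives \<open>i = (i - 1) mod n + 1\<close>.\<close>
    have "(TPro K ^^ k) s = s \<longleftrightarrow> (i - 1 + k) mod n = (i - 1) mod n"
      using TPro_complete_funpow[OF assms(2) \<sigma> i, of k] i s_eq by auto
    also have "\<dots> \<longleftrightarrow> n dvd k"
      using mod_eq_dvd_iff_nat[of "i - 1" "i - 1 + k" n] by simp
    finally show ?thesis .
  qed
  \<comment> \<open>\<open>n\<close> is a positive multiple of itself, and every positive multiple
    of \<open>n\<close> is at least \<open>n\<close>.\<close>
  show "orbit_length (TPro K) s = n"
    unfolding orbit_length_def period
    by (rule Least_equality) (use assms(1) in \<open>auto dest: dvd_imp_le\<close>)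
qed

end
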